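(* Let $({\bf v}_n)_{n\ge 0}$ be the sequence generated by the non-ideal iterative rule with restitution coefficient $\varepsilon\in[0,1)$ (defined in the context) from ${\bf v}_0\in\mathbb{R}^2$. Then there is at most one index $n\ge 0$ with ${\bf v}_n\in\mathcal{Z}_{12}$ (the system can have at most one multiple impact), and such an index exists if and only if ${\bf v}_0\in\mathcal{Z}_{12}$.
   Context: A rigid disk is simultaneously in contact with two walls forming a corner of angle $2\alpha\in(0,\pi)$; put $k=\tan\alpha>0$. Let $\varepsilon\in[0,1)$ be a restitution coefficient. The linear velocity of the disk is a pair $(\dot x,\dot y)\in\mathbb{R}^2$. The plane of velocities is partitioned into four zones: $\mathcal{Z}_0=\{k\dot x+\dot y\le 0,\ k\dot x-\dot y\le 0\}$ (exit velocities), $\mathcal{Z}_1=\{k\dot x+\dot y\le 0,\ k\dot x-\dot y>0\}$ (impact with the first wall only), $\mathcal{Z}_2=\{k\dot x+\dot y>0,\ k\dot x-\dot y\le 0\}$ (impact with the second wall only), $\mathcal{Z}_{12}=\{k\dot x+\dot y>0,\ k\dot x-\dot y>0\}$ (multiple impact). Non-ideal iterative rule. Given ${\bf v}_n=(\dot x_n,\dot y_n)$, define ${\bf v}_{n+1}=(\dot x_{n+1},\dot y_{n+1})$ by: - if ${\bf v}_n\in\mathcal{Z}_0$: ${\bf v}_{n+1}={\bf v}_n$; - if ${\bf v}_n\in\mathcal{Z}_1$: $\dot x_{n+1}=\frac{1-\varepsilon k^2}{1+k^2}\dot x_n+\frac{(1+\varepsilon)k}{1+k^2}\dot y_n$, $\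 \dot y_{n+1}=\frac{(1+\varepsilon)k}{1+k^2}\dot x_n-\frac{\varepsilon-k^2}{1+k^2}\dot y_n$; - if ${\bf v}_n\in\mathcal{Z}_2$: $\dot x_{n+1}=\frac{1-\varepsilon k^2}{1+k^2}\dot x_n-\frac{(1+\varepsilon)k}{1+k^2}\dot y_n$, $\ \dot y_{n+1}=-\frac{(1+\varepsilon)k}{1+k^2}\dot x_n-\frac{\varepsilon-k^2}{1+k^2}\dot y_n$; - if ${\bf v}_n\in\mathcal{Z}_{12}$: $\dot x_{n+1}=\frac{-\varepsilon k^4\dot x_n^2+(1-(1+\varepsilon)k^2)\dot y_n^2}{k^4\dot x_n^2+\dot y_n^2}\,\dot x_n$, $\ \dot y_{n+1}=\frac{k^2(k^2-(1+\varepsilon))\dot x_n^2-\varepsilon\dot y_n^2}{k^4\dot x_n^2+\dot y_n^2}\,\dot y_n$. *)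

theory Defs
  imports Complex_Main
begin

text \<open>
  Velocities of the disk are pairs \<open>(x, y)\<close> of reals; \<open>k = tan \<alpha>\<close> for a corner of angle
  \<open>2\<alpha>\<close>, and \<open>e\<close> is the restitution coefficient.
\<close>

definition Z0 :: "real \<Rightarrow> (real \<times> real) set" where
  "Z0 k = {(x, y). k * x + y \<le> 0 \<and> k * x - y \<le> 0}"

definition Z1 :: "real \<Rightarrow> (real \<times> real) set" where
  "Z1 k = {(x, y). k * x + y \<le> 0 \<and> k * x - y > 0}"

definition Z2 :: "real \<Rightarrow> (real \<times> real) set" where
  "Z2 k = {(x, y). k * x + y > 0 \<and> k * x - y \<le> 0}"

definition Z12 :: "real \<Rightarrow> (real \<times> real) set" where
  "Z12 k = {(x, y). k * x + y > 0 \<and> k * x - y > 0}"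

definition impact1 :: "real \<Rightarrow> real \<Rightarrow> real \<times> real \<Rightarrow> real \<times> real" where
  "impact1 e k = (\<lambda>(x, y).
     ((1 - e * k^2) / (1 + k^2) * x + (1 + e) * k / (1 + k^2) * y,
      (1 + e) * k / (1 + k^2) * x - (e - k^2) / (1 + k^2) * y))"

definition impact2 :: "real \<Rightarrow> real \<Rightarrow> real \<times> real \<Rightarrow> real \<times> real" where
  "impact2 e k = (\<lambda>(x, y).
     ((1 - e * k^2) / (1 + k^2) * x - (1 + e) * k / (1 + k^2) * y,
      - ((1 + e) * k / (1 + k^2)) * x - (e - k^2) / (1 + k^2) * y))"

definition impact12 :: "real \<Rightarrow> real \<Rightarrow> real \<times> real \<Rightarrow> real \<times> real" where
  "impact12 e k = (\<lambda>(x, y).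
     ((- e * k^4 * x^2 + (1 - (1 + e) * k^2) * y^2) / (k^4 * x^2 + y^2) * x,
      (k^2 * (k^2 - (1 + e)) * x^2 - e * y^2) / (k^4 * x^2 + y^2) * y))"

text \<open>The four zones partition the plane, so the final branch is the case \<open>v \<in> Z12 k\<close>.\<close>

definition impact_step :: "real \<Rightarrow> real \<Rightarrow> real \<times> real \<Rightarrow> real \<times> real" where
  "impact_step e k v =
     (if v \<in> Z0 k then v
      else if v \<in> Z1 k then impact1 e k v
      else if v \<in> Z2 k then impact2 e k v
      else impact12 e k v)"

end

theory Submission
  imports Defs
begin

text \<open>
  The approach speeds towards the two walls are, up to a common factor, \<open>k x + y\<close> (second wall)
  and \<open>k x - y\<close> (first wall); a multiple impact means that both are positive. The point is that
  no step of the rule ever ends in \<open>Z12\<close>, so only the index \<open>0\<close> can be a multiple impact.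

  A single impact multiplies the approach speed towards the wall that is hit by \<open>-e\<close>, which makes
  it nonpositive (\<open>impact1_rebound\<close>, \<open>impact2_rebound\<close>). For a multiple impact the two new approach
  speeds are, up to a nonnegative factor, two explicit cubic forms in \<open>k x\<close> and \<open>y\<close>. Each is the
  sum of a dissipative part proportional to \<open>-e\<close> and a part proportional to \<open>y (k\<^sup>2 - 1)\<close>, the
  latter with opposite signs in the two forms. The sign of \<open>y (k\<^sup>2 - 1)\<close> therefore decides which
  wall the disk is certain not to approach, and for that wall the dissipative part is nonpositive
  as well (\<open>impact12_notin_Z12\<close>).
\<close>

lemma impact1_rebound:
  assumes "impact1 e k (x, y) = (x', y')"
  shows "k * x' - y' = - e * (k * x - y)"
proof -
  have pos: "1 + k\<^sup>2 > 0"
    by (smt (verit) zero_le_power2)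
  have "x' = (1 - e * k\<^sup>2) / (1 + k\<^sup>2) * x + (1 + e) * k / (1 + k\<^sup>2) * y"
    and "y' = (1 + e) * k / (1 + k\<^sup>2) * x - (e - k\<^sup>2) / (1 + k\<^sup>2) * y"
    using assms by (auto simp: impact1_def)
  then have "(1 + k\<^sup>2) * x' = (1 - e * k\<^sup>2) * x + (1 + e) * k * y"
    and "(1 + k\<^sup>2) * y' = (1 + e) * k * x - (e - k\<^sup>2) * y"
    using pos by (simp_all add: distrib_left right_diff_distrib)
  then have "(1 + k\<^sup>2) * (k * x' - y') = (1 + k\<^sup>2) * (- e * (k * x - y))"
    by algebra
  then show ?thesis using pos by (metis mult_left_cancel less_irrefl)
qed

text \<open>The reflection \<open>y \<mapsto> -y\<close> in the axis of the corner exchanges the two walls.\<close>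

lemma impact2_reflect:
  assumes "impact2 e k (x, y) = (x', y')"
  shows "impact1 e k (x, - y) = (x', - y')"
  using assms by (auto simp: impact1_def impact2_def)

lemma impact2_rebound:
  assumes "impact2 e k (x, y) = (x', y')"
  shows "k * x' + y' = - e * (k * x + y)"
  using impact1_rebound[OF impact2_reflect[OF assms]] by simp

lemma impact12_notin_Z12:
  assumes k: "0 < k" and e: "0 \<le> e" and v: "v \<in> Z12 k"
  shows "impact12 e k v \<notin> Z12 k"
proof -
  obtain x y where xy: "v = (x, y)" by force
  define s where "s = k * x"
  define N where "N = - e * k^4 * x\<^sup>2 + (1 - (1 + e) * k\<^sup>2) * y\<^sup>2"
  define M where "M = k\<^sup>2 * (k\<^sup>2 - (1 + e)) * x\<^sup>2 - e * y\<^sup>2"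
  define D where "D = k^4 * x\<^sup>2 + y\<^sup>2"
  have plus: "s + y > 0" and minus: "s - y > 0"
    using v by (auto simp: Z12_def xy s_def)
  have s: "s > 0" using plus minus by linarith
  have D: "D \<ge> 0" by (simp add: D_def)
  have image: "impact12 e k v = (N / D * x, M / D * y)"
    by (simp add: impact12_def xy N_def M_def D_def)
  have toward2: "k * (N / D * x) + M / D * y = (s * N + y * M) / D"
    and toward1: "k * (N / D * x) - M / D * y = (s * N - y * M) / D"
    by (simp_all add: s_def add_divide_distrib diff_divide_distrib mult_ac)
  have form2: "s * N + y * M = - e * (k\<^sup>2 * s + y) * (s\<^sup>2 + y\<^sup>2) + s * (s - y) * (y * (k\<^sup>2 - 1))"
    unfolding N_def M_def s_def by algebra
  have form1: "s * N - y * M = - e * (k\<^sup>2 * s - y) * (s\<^sup>2 + y\<^sup>2) - s * (s + y) * (y * (k\<^sup>2 - 1))"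
    unfolding N_def M_def s_def by algebra
  show ?thesis
  proof (cases "y * (k\<^sup>2 - 1) \<le> 0")
    case True
    have "k\<^sup>2 * s + y \<ge> 0"
    proof (cases "y \<ge> 0")
      case False
      then have "1 \<le> k\<^sup>2" using True by (simp add: mult_le_0_iff)
      then have "s \<le> k\<^sup>2 * s" using s by simp
      then show ?thesis using plus by linarith
    qed (use s in simp)
    then have "e * (k\<^sup>2 * s + y) * (s\<^sup>2 + y\<^sup>2) \<ge> 0" using e by simp
    moreover have "s * (s - y) * (y * (k\<^sup>2 - 1)) \<le> 0"
      by (rule mult_nonneg_nonpos[OF _ True]) (use s minus in simp)
    ultimately have "s * N + y * M \<le> 0" unfolding form2 by simp
    then have "(s * N + y * M) / D \<le> 0" using D by (simp add: divide_le_0_iff)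
    then show ?thesis by (simp only: image Z12_def toward2 mem_Collect_eq case_prod_conv) simp
  next
    case False
    have "k\<^sup>2 * s - y \<ge> 0"
    proof (cases "y \<le> 0")
      case True
      moreover have "k\<^sup>2 * s \<ge> 0" using s by simp
      ultimately show ?thesis by linarith
    next
      case y: False
      then have "1 \<le> k\<^sup>2" using False by (simp add: mult_le_0_iff)
      then have "s \<le> k\<^sup>2 * s" using s by simp
      then show ?thesis using minus by linarith
    qed
    then have "e * (k\<^sup>2 * s - y) * (s\<^sup>2 + y\<^sup>2) \<ge> 0" using e by simp
    moreover have "s * (s + y) * (y * (k\<^sup>2 - 1)) \<ge> 0"
      by (rule mult_nonneg_nonneg) (use False s plus in simp_all)
    ultimately have "s * N - y * M \<le> 0" unfolding form1 by simp
    then have "(s * N - y * M) / D \<le> 0" using D by (simp add: divide_le_0_iff)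
    then show ?thesis by (simp only: image Z12_def toward1 mem_Collect_eq case_prod_conv) simp
  qed
qed

lemma impact_step_notin_Z12:
  assumes k: "0 < k" and e: "0 \<le> e"
  shows "impact_step e k v \<notin> Z12 k"
proof -
  obtain x y where xy: "v = (x, y)" by force
  consider "v \<in> Z0 k" | "v \<notin> Z0 k" "v \<in> Z1 k" | "v \<notin> Z0 k" "v \<notin> Z1 k" "v \<in> Z2 k"
    | "v \<notin> Z0 k" "v \<notin> Z1 k" "v \<notin> Z2 k" by blast
  then show ?thesis
  proof cases
    case 1
    then show ?thesis by (auto simp: impact_step_def Z0_def Z12_def)
  next
    case 2
    obtain x' y' where im: "impact1 e k (x, y) = (x', y')" by force
    have "e * (k * x - y) \<ge> 0" using 2 e by (auto simp: xy Z1_def)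
    then have "k * x' - y' \<le> 0" using impact1_rebound[OF im] by simp
    then show ?thesis using 2 im by (simp add: impact_step_def xy Z12_def)
  next
    case 3
    obtain x' y' where im: "impact2 e k (x, y) = (x', y')" by force
    have "e * (k * x + y) \<ge> 0" using 3 e by (auto simp: xy Z2_def)
    then have "k * x' + y' \<le> 0" using impact2_rebound[OF im] by simp
    then show ?thesis using 3 im by (simp add: impact_step_def xy Z12_def)
  next
    case 4
    then have "v \<in> Z12 k" by (auto simp: xy Z0_def Z1_def Z2_def Z12_def)
    then show ?thesis using 4 impact12_notin_Z12[OF k e] by (simp add: impact_step_def)
  qed
qed

theorem mainTheorem6:
  fixes \<alpha> k e :: real and v :: "nat \<Rightarrow> real \<times> real"
  assumes "0 < 2 * \<alpha>" and "2 * \<alpha> < pi"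
    and "k = tan \<alpha>"
    and "0 \<le> e" and "e < 1"
    and "\<And>n. v (Suc n) = impact_step e k (v n)"
  shows "(\<exists>\<^sub>\<le>\<^sub>1 n. v n \<in> Z12 k) \<and> ((\<exists>n. v n \<in> Z12 k) \<longleftrightarrow> v 0 \<in> Z12 k)"
proof -
  have "0 < k" using assms(1-3) by (simp add: tan_gt_zero)
  then have "v (Suc n) \<notin> Z12 k" for n
    using impact_step_notin_Z12 assms(4,6) by simp
  then have "n = 0" if "v n \<in> Z12 k" for n
    using that by (cases n) auto
  then show ?thesis by (auto simp: Uniq_def)
qed

end
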